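(* Let $M\ge 1$ and let $\Phi=\{\phi_n\}_{n=1}^N$ be a finite family of vectors in $\mathbb{C}^M$. If $\Phi$ does phase retrieval in $\mathbb{C}^M$, then $\Phi$ does phaseless reconstruction in $\mathbb{C}^M$.
   Context: $\mathbb{C}^M$ carries the standard inner product; vectors are written in coordinates, $x=(a_1,\dots,a_M)$. Same phases: $x=(a_1,\dots,a_M)$ and $y=(b_1,\dots,b_M)$ have the same phases if $a_i$ and $b_i$ have the same phase for every $i=1,\dots,M$. Zero has no phase, so this means that for every $i$ either $a_i=b_i=0$, or $a_i\neq 0\neq b_i$ and $a_i/|a_i|=b_i/|b_i|$. Phase retrieval: $\{\phi_n\}_{n=1}^N$ does phase retrieval if for all $x,y\in\mathbb{C}^M$ with $|\langle x,\phi_n\rangle|=|\langle y,\phi_n\rangle|$ for all $n=1,\dots,N$, there is $\theta\in\mathbb{C}$ with $|\theta|=1$ such that $x$ and $\theta y$ have the same phases. Phaseless reconstruction: $\{\phi_n\}_{n=1}^N$ does phaseless reconstruction if for all $x,y\in\mathbb{C}^M$ with $|\langle x,\phi_n\rangle|=|\langle y,\phi_n\rangle|$ for all $n=1,\dots,N$, there is $\theta\in\mathbb{C}$ with $|\theta|=1$ such that $x=\theta y$. *)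

theory Defs
  imports "Jordan_Normal_Form.Matrix"
begin

definition same_phase :: "complex \<Rightarrow> complex \<Rightarrow> bool" where
  "same_phase a b \<longleftrightarrow>
     (a = 0 \<and> b = 0) \<or>
     (a \<noteq> 0 \<and> b \<noteq> 0 \<and> a / complex_of_real (cmod a) = b / complex_of_real (cmod b))"

definition same_phases :: "nat \<Rightarrow> complex vec \<Rightarrow> complex vec \<Rightarrow> bool" where
  "same_phases M x y \<longleftrightarrow> (\<forall>i<M. same_phase (x $ i) (y $ i))"

text \<open>The space of \<open>M\<close>-tuples is \<open>carrier_vec M\<close>, with coordinates indexed from 0. The
  product \<open>x \<bullet>c y\<close> is the standard inner product, conjugate-linear in its second argument.\<close>

definition same_measurements ::
  "nat \<Rightarrow> (nat \<Rightarrow> complex vec) \<Rightarrow> complex vec \<Rightarrow> complex vec \<Rightarrow> bool" where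
  "same_measurements N \<phi> x y \<longleftrightarrow> (\<forall>n\<in>{1..N}. cmod (x \<bullet>c \<phi> n) = cmod (y \<bullet>c \<phi> n))"

definition phase_retrieval :: "nat \<Rightarrow> nat \<Rightarrow> (nat \<Rightarrow> complex vec) \<Rightarrow> bool" where
  "phase_retrieval M N \<phi> \<longleftrightarrow>
     (\<forall>x\<in>carrier_vec M. \<forall>y\<in>carrier_vec M. same_measurements N \<phi> x y \<longrightarrow>
        (\<exists>\<theta>. cmod \<theta> = 1 \<and> same_phases M x (\<theta> \<cdot>\<^sub>v y)))"

definition phaseless_reconstruction :: "nat \<Rightarrow> nat \<Rightarrow> (nat \<Rightarrow> complex vec) \<Rightarrow> bool" where
  "phaseless_reconstruction M N \<phi> \<longleftrightarrow>
     (\<forall>x\<in>carrier_vec M. \<forall>y\<in>carrier_vec M. same_measurements N \<phi> x y \<longrightarrow>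
        (\<exists>\<theta>. cmod \<theta> = 1 \<and> x = \<theta> \<cdot>\<^sub>v y))"

end

theory Submission imports Defs begin

text \<open>With \<open>u = x + y\<close> and \<open>v = x - y\<close>, equality of the measurements says that
  \<open>\<langle>u, \<phi>\<^sub>n\<rangle>\<close> and \<open>\<langle>v, \<phi>\<^sub>n\<rangle>\<close> are orthogonal as plane vectors, a condition on \<open>(u, v)\<close> that
  survives replacing \<open>v\<close> by \<open>t v\<close> with \<open>t\<close> real, and adding a real multiple of \<open>\<i> u\<close> to \<open>v\<close>.
  Phase retrieval for \<open>u + t v\<close> and \<open>u - t v\<close> says that the numbers
  \<open>(u\<^sub>i + t v\<^sub>i) cnj (u\<^sub>i - t v\<^sub>i) = |u\<^sub>i|\<^sup>2 - t\<^sup>2 |v\<^sub>i|\<^sup>2 + 2 \<i> t Im (v\<^sub>i cnj u\<^sub>i)\<close>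
  all lie on one ray; comparing \<open>t = 1\<close> and \<open>t = 2\<close> shows that \<open>Im (v\<^sub>i cnj u\<^sub>i)\<close> is
  proportional to \<open>|u\<^sub>i|\<^sup>2\<close>. Subtracting a multiple of \<open>\<i> u\<close> from \<open>v\<close>, one may assume that all
  \<open>v\<^sub>i cnj u\<^sub>i\<close> are real, and then the phase condition forces \<open>u = 0\<close> or \<open>v = 0\<close>.
  So \<open>x - y\<close> is an imaginary multiple of \<open>x + y\<close>, or \<open>x + y = 0\<close>.\<close>

definition orthogonal_measurements ::
  "nat \<Rightarrow> (nat \<Rightarrow> complex vec) \<Rightarrow> complex vec \<Rightarrow> complex vec \<Rightarrow> bool" where
  "orthogonal_measurements N \<phi> u v \<longleftrightarrow>
     (\<forall>n\<in>{1..N}. Re ((u \<bullet>c \<phi> n) * cnj (v \<bullet>c \<phi> n)) = 0)"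

lemma nonzero_vec_index:
  assumes "v \<in> carrier_vec n" "v \<noteq> 0\<^sub>v n"
  obtains i where "i < n" "v $ i \<noteq> 0"
proof (rule ccontr)
  assume "\<not> thesis"
  with that have "\<And>i. i < n \<Longrightarrow> v $ i = 0" by blast
  then have "v = 0\<^sub>v n" using assms(1) by (intro eq_vecI) auto
  with assms(2) show False by simp
qed

lemma cmod_add_eq_cmod_diff_iff:
  "cmod (p + q) = cmod (p - q) \<longleftrightarrow> Re (p * cnj q) = 0"
proof -
  have "(cmod (p + q))\<^sup>2 - (cmod (p - q))\<^sup>2 = 4 * Re (p * cnj q)"
    unfolding cmod_power2 by (simp add: power2_eq_square algebra_simps)
  moreover have "cmod (p + q) = cmod (p - q) \<longleftrightarrow> (cmod (p + q))\<^sup>2 = (cmod (p - q))\<^sup>2"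
    by (simp add: power2_eq_iff_nonneg)
  ultimately show ?thesis by linarith
qed

text \<open>Equal phases make \<open>a\<close> the multiple \<open>cmod a / cmod b\<close> of
  \<open>\<theta> * b\<close>, and \<open>b * cnj b\<close> is the square of
  \<open>cmod b\<close>.\<close>

lemma same_phase_mult_cnj:
  assumes "same_phase a (\<theta> * b)" and "cmod \<theta> = 1"
  shows "a * cnj b = \<theta> * of_real (cmod a * cmod b)"
proof (cases "a = 0")
  case False
  with assms have "b \<noteq> 0" and "a / of_real (cmod a) = \<theta> * b / of_real (cmod b)"
    by (auto simp: same_phase_def norm_mult)
  then have "a = \<theta> * b * of_real (cmod a) / of_real (cmod b)"
    using False by (simp add: field_simps)
  then have "a * cnj b = \<theta> * of_real (cmod a) * (b * cnj b) / of_real (cmod b)"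
    by (metis (no_types, lifting) mult.assoc mult.commute times_divide_eq_left)
  also have "\<dots> = \<theta> * of_real (cmod a * cmod b)"
    using \<open>b \<noteq> 0\<close> by (simp add: complex_norm_square[symmetric] power2_eq_square)
  finally show ?thesis .
qed simp

text \<open>This eliminates the unknown \<open>\<theta>\<close>: both products lie on the ray
  through it, and \<open>\<theta> * cnj \<theta> = 1\<close>.\<close>

lemma same_phase_products:
  assumes "cmod \<theta> = 1" "same_phase a (\<theta> * b)" "same_phase a' (\<theta> * b')"
  shows "(a * cnj b) * cnj (a' * cnj b') = of_real (cmod a * cmod b * cmod a' * cmod b')"
proof -
  have "\<theta> * cnj \<theta> = 1"
    using assms(1) by (simp add: complex_norm_square[symmetric])
  then show ?thesis
    unfolding same_phase_mult_cnj[OF assms(2,1)] same_phase_mult_cnj[OF assms(3,1)]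
    by (simp add: algebra_simps)
qed

context
  fixes M N :: nat and \<phi> :: "nat \<Rightarrow> complex vec"
  assumes frame: "\<And>n. n \<in> {1..N} \<Longrightarrow> \<phi> n \<in> carrier_vec M"
begin

lemma same_measurements_iff_orthogonal:
  assumes "u \<in> carrier_vec M" "v \<in> carrier_vec M"
  shows "same_measurements N \<phi> (u + v) (u - v) \<longleftrightarrow> orthogonal_measurements N \<phi> u v"
  unfolding same_measurements_def orthogonal_measurements_def
proof (intro ball_cong refl)
  fix n assume "n \<in> {1..N}"
  then have "conjugate (\<phi> n) \<in> carrier_vec M" using frame by simp
  then show "cmod ((u + v) \<bullet>c \<phi> n) = cmod ((u - v) \<bullet>c \<phi> n) \<longleftrightarrow>
    Re ((u \<bullet>c \<phi> n) * cnj (v \<bullet>c \<phi> n)) = 0"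
    using assms cmod_add_eq_cmod_diff_iff
    by (simp add: add_scalar_prod_distrib[of _ M] minus_scalar_prod_distrib[of _ M])
qed

lemma orthogonal_measurements_smult:
  assumes "u \<in> carrier_vec M" "v \<in> carrier_vec M" "orthogonal_measurements N \<phi> u v"
  shows "orthogonal_measurements N \<phi> u (of_real t \<cdot>\<^sub>v v)"
  unfolding orthogonal_measurements_def
proof
  fix n assume n: "n \<in> {1..N}"
  then have "(of_real t \<cdot>\<^sub>v v) \<bullet>c \<phi> n = of_real t * (v \<bullet>c \<phi> n)"
    using frame assms by (intro scalar_prod_smult_left) (metis carrier_vecD dim_vec_conjugate)
  moreover have "Re ((u \<bullet>c \<phi> n) * cnj (v \<bullet>c \<phi> n)) = 0"
    using assms(3) n by (simp add: orthogonal_measurements_def)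
  then have "Re (of_real t * ((u \<bullet>c \<phi> n) * cnj (v \<bullet>c \<phi> n))) = 0" by simp
  ultimately show "Re ((u \<bullet>c \<phi> n) * cnj ((of_real t \<cdot>\<^sub>v v) \<bullet>c \<phi> n)) = 0"
    by (simp only: complex_cnj_mult complex_cnj_complex_of_real mult.left_commute)
qed

text \<open>For a measurement \<open>p\<close> of \<open>u\<close>, the new term is
  \<open>\<i> * r * p * cnj p\<close>, which is purely imaginary.\<close>

lemma orthogonal_measurements_diff_imaginary:
  assumes "u \<in> carrier_vec M" "v \<in> carrier_vec M" "orthogonal_measurements N \<phi> u v"
  shows "orthogonal_measurements N \<phi> u (v - (\<i> * of_real r) \<cdot>\<^sub>v u)"
  unfolding orthogonal_measurements_def
proof
  fix n assume n: "n \<in> {1..N}"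
  then have c: "conjugate (\<phi> n) \<in> carrier_vec M" using frame by simp
  then have "(v - (\<i> * of_real r) \<cdot>\<^sub>v u) \<bullet>c \<phi> n = v \<bullet>c \<phi> n - \<i> * of_real r * (u \<bullet>c \<phi> n)"
    using assms by (simp add: minus_scalar_prod_distrib[of _ M])
  moreover have "Re ((u \<bullet>c \<phi> n) * cnj (v \<bullet>c \<phi> n)) = 0"
    using assms(3) n by (simp add: orthogonal_measurements_def)
  ultimately show "Re ((u \<bullet>c \<phi> n) * cnj ((v - (\<i> * of_real r) \<cdot>\<^sub>v u) \<bullet>c \<phi> n)) = 0"
    by (simp only:) (simp add: algebra_simps)
qed

context
  assumes retrieval: "phase_retrieval M N \<phi>"
begin

text \<open>The phase \<open>\<theta>\<close> may depend on \<open>t\<close>, but it is common to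
  all coordinates; this is what links different coordinates later.\<close>

lemma orthogonal_measurements_same_phase:
  fixes t :: real
  assumes "u \<in> carrier_vec M" "v \<in> carrier_vec M" "orthogonal_measurements N \<phi> u v"
  obtains \<theta> where "cmod \<theta> = 1"
    "\<And>i. i < M \<Longrightarrow> same_phase (u $ i + of_real t * v $ i) (\<theta> * (u $ i - of_real t * v $ i))"
proof -
  let ?w = "of_real t \<cdot>\<^sub>v v"
  have "same_measurements N \<phi> (u + ?w) (u - ?w)"
    using same_measurements_iff_orthogonal[of u ?w] orthogonal_measurements_smult[OF assms]
      assms by simp
  then obtain \<theta> where "cmod \<theta> = 1" "same_phases M (u + ?w) (\<theta> \<cdot>\<^sub>v (u - ?w))"
    using retrieval[unfolded phase_retrieval_def, rule_format, of "u + ?w" "u - ?w"] assms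
    by auto
  then show ?thesis
    using assms by (intro that[of \<theta>]) (auto simp: same_phases_def)
qed

text \<open>First \<open>u\<close> and \<open>v\<close> are shown to have disjoint supports; then no
  single \<open>\<theta>\<close> can serve both supports unless one is empty.\<close>

lemma real_quotients_imp_zero:
  assumes u: "u \<in> carrier_vec M" and v: "v \<in> carrier_vec M"
    and orth: "orthogonal_measurements N \<phi> u v"
    and real: "\<And>i. i < M \<Longrightarrow> Im (v $ i * cnj (u $ i)) = 0"
  shows "u = 0\<^sub>v M \<or> v = 0\<^sub>v M"
proof -
  have coord: "u $ i = 0 \<or> v $ i = 0" if i: "i < M" for i
  proof (rule ccontr)
    assume nz: "\<not> (u $ i = 0 \<or> v $ i = 0)"
    define s where "s = Re (v $ i * cnj (u $ i))"
    \<comment> \<open>The root of \<open>(cmod (u $ i))\<^sup>2 + t * s = 0\<close>: it makes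
      \<open>u $ i + t * v $ i\<close> vanish. Only zero shares the phase of zero, so
      \<open>u $ i - t * v $ i\<close> vanishes too.\<close>
    define t where "t = - ((cmod (u $ i))\<^sup>2 / s)"
    have s: "v $ i * cnj (u $ i) = of_real s"
      using real[OF i] by (simp add: s_def complex_eq_iff)
    then have "s \<noteq> 0" using nz by auto
    have "(u $ i + of_real t * v $ i) * cnj (u $ i) = 0"
      unfolding distrib_right mult.assoc s complex_norm_square[symmetric]
      using \<open>s \<noteq> 0\<close> by (simp add: t_def)
    then have zero: "u $ i + of_real t * v $ i = 0" using nz by simp
    obtain \<theta> where "cmod \<theta> = 1"
      "same_phase (u $ i + of_real t * v $ i) (\<theta> * (u $ i - of_real t * v $ i))"
      using orthogonal_measurements_same_phase[OF u v orth] i by metis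
    with zero have "u $ i - of_real t * v $ i = 0" by (auto simp: same_phase_def)
    with zero have "2 * u $ i = 0" by (simp add: algebra_simps)
    with nz show False by simp
  qed
  show ?thesis
  proof (rule ccontr)
    assume "\<not> ?thesis"
    then obtain i j where ij: "i < M" "j < M" "u $ i \<noteq> 0" "v $ j \<noteq> 0"
      using nonzero_vec_index[OF u] nonzero_vec_index[OF v] by metis
    then have z: "v $ i = 0" "u $ j = 0" using coord by blast+
    obtain \<theta> where \<theta>: "cmod \<theta> = 1"
      "\<And>i. i < M \<Longrightarrow> same_phase (u $ i + of_real 1 * v $ i) (\<theta> * (u $ i - of_real 1 * v $ i))"
      using orthogonal_measurements_same_phase[OF u v orth] by metis
    \<comment> \<open>Coordinate \<open>i\<close> sees only \<open>u\<close>, which has equal signs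
      in the two vectors; coordinate \<open>j\<close> sees only \<open>v\<close>, which has opposite
      signs.\<close>
    have "same_phase (u $ i) (\<theta> * u $ i)" "same_phase (v $ j) (\<theta> * - v $ j)"
      using \<theta>(2)[OF ij(1)] \<theta>(2)[OF ij(2)] z by auto
    then have "\<theta> = 1" "\<theta> = -1"
      using ij \<theta>(1) by (auto simp: same_phase_def norm_mult field_simps)
    then show False by simp
  qed
qed

lemma im_proportional_to_norm_square:
  assumes u: "u \<in> carrier_vec M" and v: "v \<in> carrier_vec M"
    and orth: "orthogonal_measurements N \<phi> u v" and ij: "i < M" "j < M"
  shows "Im (v $ i * cnj (u $ i)) * (cmod (u $ j))\<^sup>2 = Im (v $ j * cnj (u $ j)) * (cmod (u $ i))\<^sup>2"
proof -
  define a b c where "a k = (cmod (u $ k))\<^sup>2" and "b k = (cmod (v $ k))\<^sup>2"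
    and "c k = Im (v $ k * cnj (u $ k))" for k
  have key: "c i * (a j - t\<^sup>2 * b j) = c j * (a i - t\<^sup>2 * b i)" if "t \<noteq> 0" for t :: real
  proof -
    define p where "p k = (u $ k + of_real t * v $ k) * cnj (u $ k - of_real t * v $ k)" for k
    have p: "Re (p k) = a k - t\<^sup>2 * b k" "Im (p k) = 2 * t * c k" for k
      unfolding p_def a_def b_def c_def cmod_power2
      by (simp_all add: power2_eq_square algebra_simps)
    obtain \<theta> where "cmod \<theta> = 1"
      "\<And>i. i < M \<Longrightarrow> same_phase (u $ i + of_real t * v $ i) (\<theta> * (u $ i - of_real t * v $ i))"
      using orthogonal_measurements_same_phase[OF u v orth] by metis
    \<comment> \<open>All \<open>p k\<close> lie on one ray, so \<open>p i\<close> and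
      \<open>p j\<close> are parallel as plane vectors.\<close>
    then have "Im (p i * cnj (p j)) = 0"
      unfolding p_def using ij by (subst same_phase_products) auto
    then have "Im (p i) * Re (p j) = Im (p j) * Re (p i)" by simp
    then have "2 * t * (c i * (a j - t\<^sup>2 * b j)) = 2 * t * (c j * (a i - t\<^sup>2 * b i))"
      unfolding p by (simp only: mult.assoc)
    then show ?thesis using that by simp
  qed
  \<comment> \<open>By \<open>key\<close>, \<open>c i * a j - c j * a i\<close> equals
    \<open>t\<^sup>2\<close> times a quantity free of \<open>t\<close>; the values 1 and 4 of
    \<open>t\<^sup>2\<close> force both to be 0.\<close>
  have "c i * a j = c j * a i"
    using key[of 1] key[of 2] by (simp add: algebra_simps)
  then show ?thesis by (simp add: a_def c_def)
qed

lemma orthogonal_measurements_imp_imaginary_multiple: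
  assumes u: "u \<in> carrier_vec M" and v: "v \<in> carrier_vec M"
    and orth: "orthogonal_measurements N \<phi> u v"
  shows "u = 0\<^sub>v M \<or> (\<exists>r::real. v = (\<i> * of_real r) \<cdot>\<^sub>v u)"
proof (cases "u = 0\<^sub>v M")
  case False
  then obtain i where i: "i < M" "u $ i \<noteq> 0"
    using nonzero_vec_index[OF u] by metis
  \<comment> \<open>The proportionality constant, read off at a coordinate where \<open>u\<close> is
    nonzero; subtracting \<open>\<i> * r * u\<close> then cancels every imaginary part.\<close>
  define r where "r = Im (v $ i * cnj (u $ i)) / (cmod (u $ i))\<^sup>2"
  let ?w = "v - (\<i> * of_real r) \<cdot>\<^sub>v u"
  have "Im (?w $ j * cnj (u $ j)) = 0" if j: "j < M" for j
  proof -
    have "Im (v $ j * cnj (u $ j)) = r * (cmod (u $ j))\<^sup>2"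
      using im_proportional_to_norm_square[OF u v orth i(1) j] i(2)
      by (simp add: r_def field_simps)
    then show ?thesis
      using u v j unfolding cmod_power2 by (simp add: power2_eq_square algebra_simps)
  qed
  then have w: "?w = 0\<^sub>v M"
    using real_quotients_imp_zero[OF u _ orthogonal_measurements_diff_imaginary[OF u v orth]]
      False u v by auto
  have "v = (\<i> * of_real r) \<cdot>\<^sub>v u"
  proof (rule eq_vecI)
    fix k assume "k < dim_vec ((\<i> * of_real r) \<cdot>\<^sub>v u)"
    then show "v $ k = ((\<i> * of_real r) \<cdot>\<^sub>v u) $ k"
      using arg_cong[OF w, of "\<lambda>z. z $ k"] u v by simp
  qed (use u v in simp)
  then show ?thesis by blast
qed simp

end

end

theorem theorem3p8:
  fixes M N :: nat and \<phi> :: "nat \<Rightarrow> complex vec"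
  assumes "M \<ge> 1"
    and "\<And>n. n \<in> {1..N} \<Longrightarrow> \<phi> n \<in> carrier_vec M"
    and "phase_retrieval M N \<phi>"
  shows "phaseless_reconstruction M N \<phi>"
  unfolding phaseless_reconstruction_def
proof (intro ballI impI)
  fix x y assume x: "x \<in> carrier_vec M" and y: "y \<in> carrier_vec M"
    and meas: "same_measurements N \<phi> x y"
  define u v where "u = (1/2) \<cdot>\<^sub>v (x + y)" and "v = (1/2) \<cdot>\<^sub>v (x - y)"
  have uv: "u \<in> carrier_vec M" "v \<in> carrier_vec M" using x y by (auto simp: u_def v_def)
  have "x = u + v" "y = u - v"
    using x y by (auto simp: u_def v_def intro!: eq_vecI simp: field_simps)
  then have "orthogonal_measurements N \<phi> u v"
    using same_measurements_iff_orthogonal[OF assms(2) uv] meas by simp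
  then consider "u = 0\<^sub>v M" | r :: real where "v = (\<i> * of_real r) \<cdot>\<^sub>v u"
    using orthogonal_measurements_imp_imaginary_multiple[OF assms(2,3) uv] by blast
  then show "\<exists>\<theta>. cmod \<theta> = 1 \<and> x = \<theta> \<cdot>\<^sub>v y"
  proof cases
    case 1
    then have "x = (-1) \<cdot>\<^sub>v y"
      using uv \<open>x = u + v\<close> \<open>y = u - v\<close> by (auto intro!: eq_vecI)
    then show ?thesis by (intro exI[of _ "-1"]) simp
  next
    case 2
    \<comment> \<open>Here \<open>x = cnj d * u\<close> and \<open>y = d * u\<close>; conjugate
      factors have equal modulus, and \<open>d\<close> has real part 1, so the quotient is a
      phase.\<close>
    define d where "d = 1 - \<i> * of_real r"
    have d: "d \<noteq> 0" by (simp add: d_def complex_eq_iff)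
    have cd: "cnj d = 1 + \<i> * of_real r" by (simp add: d_def)
    have "cmod (cnj d / d) = 1" using d by (simp add: norm_divide)
    moreover have "x = (cnj d / d) \<cdot>\<^sub>v y"
    proof (rule eq_vecI)
      fix k assume "k < dim_vec ((cnj d / d) \<cdot>\<^sub>v y)"
      then have "x $ k = cnj d * u $ k" "y $ k = d * u $ k" "k < dim_vec y"
        using 2 uv \<open>x = u + v\<close> \<open>y = u - v\<close> by (auto simp: cd d_def algebra_simps)
      then show "x $ k = ((cnj d / d) \<cdot>\<^sub>v y) $ k" using d by simp
    qed (use x y in simp)
    ultimately show ?thesis by blast
  qed
qed

end
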